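(* For each non-constant $g\in\mathcal{B}$ and each $\gamma>0$, the multiplier spaces of the optimal domain spaces $[V_g,A^{-\gamma}]$ and $[V_g,A^{-\gamma}_0]$ are given by $$\mathcal{M}([V_g,A^{-\gamma}])=\mathcal{M}([V_g,A^{-\gamma}_0])=H^\infty.$$
   Context: $\mathbb{D}$ is the open unit disc in $\mathbb{C}$, $H(\mathbb{D})$ is the space of analytic functions on $\mathbb{D}$, and $H^\infty$ is the space of bounded functions in $H(\mathbb{D})$. For a Banach space $X\subseteq H(\mathbb{D})$ of analytic functions (continuously included in $H(\mathbb{D})$ with the topology of uniform convergence on compact sets), $\mathcal{M}(X):=\{h\in H(\mathbb{D}): hf\in X\text{ for all }f\in X\}$. For $\gamma>0$, $A^{-\gamma}:=\{f\in H(\mathbb{D}): \|f\|_{-\gamma}:=\sup_{z\in\mathbb{D}}(1-|z|)^\gamma|f(z)|<\infty\}$ and $A^{-\gamma}_0:=\{f\in H(\mathbb{D}): \lim_{|z|\to1^-}(1-|z|)^\gamma|f(z)|=0\}$, both with norm $\|\cdot\|_{-\gamma}$. The Bloch space is $\mathcal{B}:=\{g\in H(\mathbb{D}): \sup_{z\in\mathbb{D}}(1-|z|)|g'(z)|<\infty\}$. The Volterra operator is $(V_gf)(z):=\int_0^zf(\xi)g'(\xi)\,d\xi$ for $f\in H(\mathbb{D})$, $z\in\mathbb{D}$. The optimal domains are $[V_g,A^{-\gamma}]:=\{f\in H(\mathbb{D}): V_gf\in A^{-\gamma}\}$ and $[V_g,A^{-\gamma}_0]:=\{f\in H(\mathbb{D}):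 V_gf\in A^{-\gamma}_0\}$, each endowed with the norm $f\mapsto\|V_gf\|_{-\gamma}$; these are Banach spaces of analytic functions on $\mathbb{D}$ when $g\in\mathcal{B}$ is non-constant. *)

theory Defs
  imports "HOL-Complex_Analysis.Complex_Analysis"
begin

text \<open>
  Analytic functions on the unit disc are represented by total functions that are holomorphic
  on the disc; their values outside the disc are arbitrary. Every space below is invariant
  under changing a function outside the disc, so equality of such sets of total functions is
  equality of the corresponding spaces of functions on the disc. All spaces are given by their
  underlying sets, on which alone the multipliers depend.
\<close>

abbreviation unit_disc :: "complex set" where
  "unit_disc \<equiv> ball 0 1"

definition hol_disc :: "(complex \<Rightarrow> complex) set" where
  "hol_disc = {f. f holomorphic_on unit_disc}"

definition H_infty :: "(complex \<Rightarrow> complex) set" where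
  "H_infty = {f \<in> hol_disc. bounded (f ` unit_disc)}"

definition multipliers :: "(complex \<Rightarrow> complex) set \<Rightarrow> (complex \<Rightarrow> complex) set" where
  "multipliers X = {h \<in> hol_disc. \<forall>f\<in>X. (\<lambda>z. h z * f z) \<in> X}"

definition growth_space :: "real \<Rightarrow> (complex \<Rightarrow> complex) set" where
  "growth_space \<gamma> =
     {f \<in> hol_disc. bdd_above ((\<lambda>z. (1 - norm z) powr \<gamma> * norm (f z)) ` unit_disc)}"

text \<open>
  The filter in the next definition expresses the limit as the modulus tends to 1 from below,
  uniformly in the argument.
\<close>

definition growth_space0 :: "real \<Rightarrow> (complex \<Rightarrow> complex) set" where
  "growth_space0 \<gamma> =
     {f \<in> hol_disc. ((\<lambda>z. (1 - norm z) powr \<gamma> * norm (f z)) \<longlongrightarrow> 0)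
                      (filtercomap norm (at_left 1))}"

definition Bloch :: "(complex \<Rightarrow> complex) set" where
  "Bloch = {g \<in> hol_disc. bdd_above ((\<lambda>z. (1 - norm z) * norm (deriv g z)) ` unit_disc)}"

definition Volterra :: "(complex \<Rightarrow> complex) \<Rightarrow> (complex \<Rightarrow> complex) \<Rightarrow> complex \<Rightarrow> complex" where
  "Volterra g f z = contour_integral (linepath 0 z) (\<lambda>\<xi>. f \<xi> * deriv g \<xi>)"

definition optimal_domain ::
  "(complex \<Rightarrow> complex) \<Rightarrow> (complex \<Rightarrow> complex) set \<Rightarrow> (complex \<Rightarrow> complex) set" where
  "optimal_domain g X = {f \<in> hol_disc. Volterra g f \<in> X}"

end

theory Submission
  imports Defs
begin

text \<open>
  Write \<open>F = V\<^sub>g f\<close>, so that \<open>F' = f g'\<close>. Cauchy's estimate and integration along radii show that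
  \<open>F\<close> has growth of order \<open>\<gamma>\<close> iff \<open>F'\<close> has growth of order \<open>\<gamma> + 1\<close>, in the O- and in the
  o-sense. Hence the optimal domains are weighted spaces with the weight
  \<open>u(z) = (1 - |z|)\<^sup>\<gamma>\<^sup>+\<^sup>1 |g'(z)|\<close>, and bounded functions are multipliers. Conversely, if a multiplier
  \<open>h\<close> is unbounded, then the norms \<open>b\<^sub>n\<close> of the powers \<open>h\<^sup>n\<close> are finite, but \<open>b\<^sub>n\<^sub>+\<^sub>1 / b\<^sub>n\<close> is
  unbounded; a gliding hump argument then produces a norm convergent series \<open>f\<close> of multiples of
  powers of \<open>h\<close> for which \<open>h f\<close> has infinite norm.
\<close>

section \<open>Growth of a function and of its derivative\<close>

text \<open>The o-arguments below are carried out with thresholds instead of filters. A negative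
  \<open>r\<close> is admissible and makes the bound hold on the whole disc.\<close>

lemma tendsto_0_norm_at_left_iff:
  fixes q :: "'a::real_normed_vector \<Rightarrow> 'b::real_normed_vector"
  shows "(q \<longlongrightarrow> 0) (filtercomap norm (at_left 1)) \<longleftrightarrow>
    (\<forall>\<epsilon>>0. \<exists>r<1. \<forall>z. r < norm z \<longrightarrow> norm z < 1 \<longrightarrow> norm (q z) < \<epsilon>)"
proof -
  have "eventually P (filtercomap norm (at_left 1)) \<longleftrightarrow>
      (\<exists>r<1. \<forall>z. r < norm z \<longrightarrow> norm z < 1 \<longrightarrow> P z)" for P :: "'a \<Rightarrow> bool"
  proof
    assume "eventually P (filtercomap norm (at_left 1))"
    then show "\<exists>r<1. \<forall>z. r < norm z \<longrightarrow> norm z < 1 \<longrightarrow> P z"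
      unfolding eventually_filtercomap eventually_at_left_field by blast
  next
    assume "\<exists>r<1. \<forall>z. r < norm z \<longrightarrow> norm z < 1 \<longrightarrow> P z"
    then obtain r where "r < 1" "\<And>z. r < norm z \<Longrightarrow> norm z < 1 \<Longrightarrow> P z" by blast
    then show "eventually P (filtercomap norm (at_left 1))"
      unfolding eventually_filtercomap eventually_at_left_field
      by (intro exI[of _ "\<lambda>t. r < t \<and> t < 1"]) auto
  qed
  then show ?thesis by (simp add: tendsto_iff)
qed

text \<open>Integration along the radius from modulus \<open>r\<close> to |z|: the bound
  \<open>c (1 - t) powr (- \<gamma> - 1)\<close> has the primitive
  \<open>c / \<gamma> (1 - t) powr (- \<gamma>)\<close>, and the weight at \<open>z\<close> turns
  this into \<open>c / \<gamma>\<close>. The starting value contributes a term that vanishes as |z|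
  tends to 1. Taking \<open>r = 0\<close> gives the O-version; taking \<open>r\<close> near 1 with
  small \<open>c\<close> gives the o-version.\<close>

lemma growth_of_primitive:
  fixes F F' :: "complex \<Rightarrow> complex"
  assumes F: "\<And>z. z \<in> unit_disc \<Longrightarrow> (F has_field_derivative F' z) (at z)"
    and \<gamma>: "\<gamma> > 0" and r: "0 \<le> r" "r < 1"
    and c: "\<And>z. \<lbrakk>r \<le> norm z; norm z < 1\<rbrakk> \<Longrightarrow> (1 - norm z) powr (\<gamma> + 1) * norm (F' z) \<le> c"
    and M: "\<And>z. norm z \<le> r \<Longrightarrow> norm (F z) \<le> M"
    and z: "r < norm z" "norm z < 1"
  shows "(1 - norm z) powr \<gamma> * norm (F z) \<le> c / \<gamma> + M * (1 - norm z) powr \<gamma>"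
proof -
  define \<zeta> where "\<zeta> = sgn z"
  have z0: "z \<noteq> 0" using z r by auto
  have n\<zeta>: "norm \<zeta> = 1" using z0 by (simp add: \<zeta>_def norm_sgn)
  have nt: "norm (of_real t * \<zeta>) = t" if "t \<ge> 0" for t using that n\<zeta> by (simp add: norm_mult)
  have z\<zeta>: "z = of_real (norm z) * \<zeta>" using z0 by (simp add: \<zeta>_def sgn_div_norm scaleR_conv_of_real)
  define \<phi> where "\<phi> = (\<lambda>t. F (of_real t * \<zeta>))"
  define \<psi> where "\<psi> = (\<lambda>t::real. c / \<gamma> * (1 - t) powr (- \<gamma>))"
  have d\<phi>: "(\<phi> has_vector_derivative (\<zeta> * F' (of_real t * \<zeta>))) (at t)" if "0 \<le> t" "t < 1" for t
  proof -
    have "((\<lambda>t. of_real t * \<zeta>) has_vector_derivative \<zeta>) (at t)"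
      by (auto intro!: derivative_eq_intros)
    from field_vector_diff_chain_at[OF this F] show ?thesis
      using that by (simp add: \<phi>_def o_def nt)
  qed
  have d\<psi>: "(\<psi> has_vector_derivative (c * (1 - t) powr (- \<gamma> - 1))) (at t)" if "t < 1" for t
  proof -
    have "((\<lambda>t. 1 - t) has_real_derivative - 1) (at t)" by (auto intro!: derivative_eq_intros)
    from DERIV_cmult[OF DERIV_fun_powr[OF this, of "- \<gamma>"], of "c / \<gamma>"] show ?thesis
      using that \<gamma> unfolding \<psi>_def by (simp add: has_real_derivative_iff_has_vector_derivative)
  qed
  have "norm (\<phi> (norm z) - \<phi> r) \<le> \<psi> (norm z) - \<psi> r"
  proof (rule differentiable_bound_general[OF z(1)])
    show "continuous_on {r..norm z} \<phi>"
      using z r by (intro continuous_at_imp_continuous_on ballI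
          has_vector_derivative_continuous[OF d\<phi>]) auto
    show "continuous_on {r..norm z} \<psi>"
      using z r by (intro continuous_at_imp_continuous_on ballI
          has_vector_derivative_continuous[OF d\<psi>]) auto
    fix t assume t: "r < t" "t < norm z"
    show "(\<phi> has_vector_derivative (\<zeta> * F' (of_real t * \<zeta>))) (at t)" using t r z d\<phi> by simp
    show "(\<psi> has_vector_derivative (c * (1 - t) powr (- \<gamma> - 1))) (at t)" using t r z d\<psi> by simp
    have "(1 - t) powr (\<gamma> + 1) * norm (F' (of_real t * \<zeta>)) \<le> c"
      using c[of "of_real t * \<zeta>"] t r z by (simp add: nt)
    moreover have "(1 - t) powr (- \<gamma> - 1) * (1 - t) powr (\<gamma> + 1) = 1"
      using t z by (simp flip: powr_add)
    ultimately have "norm (F' (of_real t * \<zeta>)) \<le> c * (1 - t) powr (- \<gamma> - 1)"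
      using mult_left_mono[of "(1 - t) powr (\<gamma> + 1) * norm (F' (of_real t * \<zeta>))" c
          "(1 - t) powr (- \<gamma> - 1)"]
      by (simp add: mult.assoc[symmetric] mult.commute[of _ c])
    then show "norm (\<zeta> * F' (of_real t * \<zeta>)) \<le> c * (1 - t) powr (- \<gamma> - 1)"
      by (simp add: norm_mult n\<zeta>)
  qed
  \<comment> \<open>The lower endpoint of the integral can then be dropped. Nonnegativity of
    \<open>c\<close> comes from its bound at \<open>z\<close> itself.\<close>
  moreover have "\<psi> r \<ge> 0"
  proof -
    have "0 \<le> c" using c[OF less_imp_le, OF z]
      by (meson mult_nonneg_nonneg norm_ge_zero order_trans powr_ge_zero)
    then show ?thesis using \<gamma> by (simp add: \<psi>_def)
  qed
  moreover have "norm (\<phi> r) \<le> M" using M[of "of_real r * \<zeta>"] r by (simp add: \<phi>_def nt)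
  moreover have "\<phi> (norm z) = F z" using z\<zeta> by (simp add: \<phi>_def)
  ultimately have "norm (F z) \<le> \<psi> (norm z) + M"
    using norm_triangle_ineq2[of "F z" "\<phi> r"] by simp
  then have "(1 - norm z) powr \<gamma> * norm (F z) \<le> (1 - norm z) powr \<gamma> * (\<psi> (norm z) + M)"
    by (intro mult_left_mono) auto
  also have "\<dots> = c / \<gamma> * ((1 - norm z) powr \<gamma> * (1 - norm z) powr - \<gamma>) + M * (1 - norm z) powr \<gamma>"
    by (simp add: \<psi>_def algebra_simps)
  also have "(1 - norm z) powr \<gamma> * (1 - norm z) powr - \<gamma> = 1"
    using z by (simp flip: powr_add)
  finally show ?thesis by simp
qed

text \<open>Cauchy's estimate on the circle around \<open>z\<close> whose radius \<rho> is half the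
  distance to the boundary. On it the distance to the boundary is at least \<rho>, and the moduli
  are at least (3|z| - 1)/2, which exceeds \<open>r\<close> exactly when |z| > (2r + 1)/3. The
  factor \<open>2 powr (\<gamma> + 1)\<close> comes from 1 - |z| = 2\<rho>.\<close>

lemma growth_of_deriv:
  assumes F: "F holomorphic_on unit_disc" and \<gamma>: "\<gamma> > 0"
    and c: "\<And>z. \<lbrakk>r < norm z; norm z < 1\<rbrakk> \<Longrightarrow> (1 - norm z) powr \<gamma> * norm (F z) \<le> c"
    and z: "(2 * r + 1) / 3 < norm z" "norm z < 1"
  shows "(1 - norm z) powr (\<gamma> + 1) * norm (deriv F z) \<le> 2 powr (\<gamma> + 1) * c"
proof -
  define \<rho> where "\<rho> = (1 - norm z) / 2"
  have \<rho>: "\<rho> > 0" using z by (simp add: \<rho>_def)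
  have sub: "cball z \<rho> \<subseteq> unit_disc"
  proof
    fix w assume "w \<in> cball z \<rho>"
    then show "w \<in> unit_disc"
      using norm_triangle_ineq2[of w z] z by (simp add: dist_norm norm_minus_commute \<rho>_def)
  qed
  have "norm ((deriv ^^ 1) F z) \<le> fact 1 * (c * \<rho> powr - \<gamma>) / \<rho> ^ 1"
  proof (rule Cauchy_inequality[OF _ _ \<rho>])
    show "F holomorphic_on ball z \<rho>" "continuous_on (cball z \<rho>) F"
      using F sub ball_subset_cball by (blast intro: holomorphic_on_subset holomorphic_on_imp_continuous_on)+
    fix x assume x: "norm (z - x) = \<rho>"
    have l: "1 - norm x \<ge> \<rho>" and "norm x > r"
      using norm_triangle_ineq2[of x z] norm_triangle_ineq2[of z x] x z
      by (simp_all add: norm_minus_commute \<rho>_def field_simps)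
    then have "(1 - norm x) powr \<gamma> * norm (F x) \<le> c" using c \<rho> by simp
    moreover have "\<rho> powr \<gamma> * norm (F x) \<le> (1 - norm x) powr \<gamma> * norm (F x)"
      using l \<rho> \<gamma> by (intro mult_right_mono powr_mono2) auto
    ultimately show "norm (F x) \<le> c * \<rho> powr - \<gamma>"
      using \<rho> by (simp add: powr_minus field_simps)
  qed
  then have "norm (deriv F z) \<le> c * \<rho> powr - \<gamma> / \<rho>" by simp
  then have "\<rho> powr (\<gamma> + 1) * norm (deriv F z) \<le> c"
    using \<rho> by (simp add: powr_minus powr_add field_simps)
  moreover have "1 - norm z = 2 * \<rho>" by (simp add: \<rho>_def)
  ultimately show ?thesis using \<rho> by (simp add: powr_mult mult.assoc)
qed

lemma growth_space_iff:
  "F \<in> growth_space \<gamma> \<longleftrightarrow> F holomorphic_on unit_disc \<and>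
    (\<exists>c. \<forall>z. norm z < 1 \<longrightarrow> (1 - norm z) powr \<gamma> * norm (F z) \<le> c)"
  by (simp add: growth_space_def hol_disc_def bdd_above_def Ball_def flip: Ball_def) (simp add: Ball_def)

lemma growth_space_iff_deriv:
  assumes F: "\<And>z. z \<in> unit_disc \<Longrightarrow> (F has_field_derivative F' z) (at z)" and \<gamma>: "\<gamma> > 0"
  shows "F \<in> growth_space \<gamma> \<longleftrightarrow> F' \<in> growth_space (\<gamma> + 1)"
proof -
  have hol: "F holomorphic_on unit_disc"
    using F unfolding holomorphic_on_open[OF open_ball] by blast
  have d: "deriv F z = F' z" if "norm z < 1" for z using F that by (simp add: DERIV_imp_deriv)
  have hol': "F' holomorphic_on unit_disc"
    by (rule holomorphic_transform[OF holomorphic_deriv[OF hol]]) (simp_all add: d)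
  show ?thesis
  proof
    assume "F \<in> growth_space \<gamma>"
    then obtain c where "\<And>z. norm z < 1 \<Longrightarrow> (1 - norm z) powr \<gamma> * norm (F z) \<le> c"
      unfolding growth_space_iff by blast
    \<comment> \<open>With \<open>r = -1\<close> both thresholds of \<open>growth_of_deriv\<close>
      are negative, so its estimate covers the whole disc.\<close>
    then have "(1 - norm z) powr (\<gamma> + 1) * norm (F' z) \<le> 2 powr (\<gamma> + 1) * c" if "norm z < 1" for z
      using growth_of_deriv[OF hol \<gamma>, of "-1" c z] that d norm_ge_zero[of z] by simp
    then show "F' \<in> growth_space (\<gamma> + 1)"
      using hol' unfolding growth_space_iff by blast
  next
    assume "F' \<in> growth_space (\<gamma> + 1)"
    then obtain c where c: "\<And>z. norm z < 1 \<Longrightarrow> (1 - norm z) powr (\<gamma> + 1) * norm (F' z) \<le> c"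
      unfolding growth_space_iff by blast
    then have c0: "c \<ge> 0" using order_trans[OF norm_ge_zero, of "F' 0" c] c[of 0] by simp
    have "(1 - norm z) powr \<gamma> * norm (F z) \<le> c / \<gamma> + norm (F 0)" if z: "norm z < 1" for z
    proof (cases "z = 0")
      case False
      then have "(1 - norm z) powr \<gamma> * norm (F z) \<le> c / \<gamma> + norm (F 0) * (1 - norm z) powr \<gamma>"
        using growth_of_primitive[OF F \<gamma>, of 0 c "norm (F 0)" z] z c by simp
      moreover have "(1 - norm z) powr \<gamma> \<le> 1"
        using z \<gamma> by (intro powr_le1) auto
      ultimately show ?thesis using mult_left_mono[of "(1 - norm z) powr \<gamma>" 1 "norm (F 0)"] by simp
    qed (use c0 \<gamma> in auto)
    then show "F \<in> growth_space \<gamma>"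
      using hol unfolding growth_space_iff by blast
  qed
qed

lemma growth_space0_iff:
  "F \<in> growth_space0 \<gamma> \<longleftrightarrow> F holomorphic_on unit_disc \<and>
    (\<forall>\<epsilon>>0. \<exists>r<1. \<forall>z. r < norm z \<longrightarrow> norm z < 1 \<longrightarrow> (1 - norm z) powr \<gamma> * norm (F z) < \<epsilon>)"
  by (simp add: growth_space0_def hol_disc_def tendsto_0_norm_at_left_iff abs_mult)

lemma growth_space0_iff_deriv:
  assumes F: "\<And>z. z \<in> unit_disc \<Longrightarrow> (F has_field_derivative F' z) (at z)" and \<gamma>: "\<gamma> > 0"
  shows "F \<in> growth_space0 \<gamma> \<longleftrightarrow> F' \<in> growth_space0 (\<gamma> + 1)"
proof -
  have hol: "F holomorphic_on unit_disc"
    using F unfolding holomorphic_on_open[OF open_ball] by blast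
  have d: "deriv F z = F' z" if "norm z < 1" for z using F that by (simp add: DERIV_imp_deriv)
  have hol': "F' holomorphic_on unit_disc"
    by (rule holomorphic_transform[OF holomorphic_deriv[OF hol]]) (simp_all add: d)
  show ?thesis
  proof
    assume F0: "F \<in> growth_space0 \<gamma>"
    show "F' \<in> growth_space0 (\<gamma> + 1)" unfolding growth_space0_iff
    proof (intro conjI allI impI hol')
      fix \<epsilon> :: real assume \<epsilon>: "\<epsilon> > 0"
      define \<delta> where "\<delta> = \<epsilon> / 2 / 2 powr (\<gamma> + 1)"
      have "\<delta> > 0" using \<epsilon> by (simp add: \<delta>_def)
      then obtain r where r: "r < 1"
        "\<And>z. r < norm z \<Longrightarrow> norm z < 1 \<Longrightarrow> (1 - norm z) powr \<gamma> * norm (F z) < \<delta>"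
        using F0 unfolding growth_space0_iff by blast
      have "(1 - norm z) powr (\<gamma> + 1) * norm (F' z) < \<epsilon>"
        if "(2 * r + 1) / 3 < norm z" "norm z < 1" for z
      proof -
        have "2 powr (\<gamma> + 1) * \<delta> = \<epsilon> / 2" by (simp add: \<delta>_def)
        with growth_of_deriv[OF hol \<gamma>, of r \<delta> z] that r(2) d \<epsilon> show ?thesis
          by (simp add: less_imp_le)
      qed
      moreover have "(2 * r + 1) / 3 < 1" using r by simp
      ultimately show "\<exists>r<1. \<forall>z. r < norm z \<longrightarrow> norm z < 1 \<longrightarrow> (1 - norm z) powr (\<gamma> + 1) * norm (F' z) < \<epsilon>"
        by blast
    qed
  next
    assume F0: "F' \<in> growth_space0 (\<gamma> + 1)"
    show "F \<in> growth_space0 \<gamma>" unfolding growth_space0_iff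
    proof (intro conjI allI impI hol)
      fix \<epsilon> :: real assume \<epsilon>: "\<epsilon> > 0"
      \<comment> \<open>Division by \<gamma> in \<open>growth_of_primitive\<close> turns this bound
        into \<epsilon>/2.\<close>
      then have "\<epsilon> * \<gamma> / 2 > 0" using \<gamma> by simp
      then obtain r0 where r0: "r0 < 1"
        "\<And>z. r0 < norm z \<Longrightarrow> norm z < 1 \<Longrightarrow> (1 - norm z) powr (\<gamma> + 1) * norm (F' z) < \<epsilon> * \<gamma> / 2"
        using F0 unfolding growth_space0_iff by blast
      \<comment> \<open>Strictly larger than \<open>r0\<close>, so that the bound on
        \<open>F'\<close> also holds on the circle |z| = \<open>r\<close>, where the integration
        starts.\<close>
      define r where "r = max 0 ((r0 + 1) / 2)"
      have r: "0 \<le> r" "r < 1" "r0 < r" using r0 by (auto simp: r_def max_def)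
      have "compact (F ` cball 0 r)"
        using r hol by (intro compact_continuous_image holomorphic_on_imp_continuous_on)
          (auto intro: holomorphic_on_subset)
      then obtain M where M: "M > 0" "\<And>z. norm z \<le> r \<Longrightarrow> norm (F z) \<le> M"
        using compact_imp_bounded[of "F ` cball 0 r"] by (auto simp: bounded_pos)
      \<comment> \<open>Beyond \<open>s\<close> the contribution
        \<open>M * (1 - norm z) powr \<gamma>\<close> of the starting value is below
        \<epsilon>/2.\<close>
      define s where "s = max r (1 - (\<epsilon> / (2 * M)) powr (1 / \<gamma>))"
      have s: "s < 1" "r \<le> s" using r \<epsilon> M by (auto simp: s_def)
      have "(1 - norm z) powr \<gamma> * norm (F z) < \<epsilon>" if z: "s < norm z" "norm z < 1" for z
      proof -
        have "(1 - norm z) powr \<gamma> * norm (F z) \<le> (\<epsilon> * \<gamma> / 2) / \<gamma> + M * (1 - norm z) powr \<gamma>"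
          by (rule growth_of_primitive[OF F \<gamma> r(1,2) _ M(2)])
            (use r r0(2) s z in \<open>auto intro: less_imp_le\<close>)
        moreover have "(1 - norm z) powr \<gamma> < ((\<epsilon> / (2 * M)) powr (1 / \<gamma>)) powr \<gamma>"
          using z \<gamma> by (intro powr_less_mono2) (auto simp: s_def)
        then have "M * (1 - norm z) powr \<gamma> < \<epsilon> / 2"
          using M \<epsilon> \<gamma> by (simp add: powr_powr field_simps)
        ultimately show ?thesis using \<gamma> by simp
      qed
      then show "\<exists>r<1. \<forall>z. r < norm z \<longrightarrow> norm z < 1 \<longrightarrow> (1 - norm z) powr \<gamma> * norm (F z) < \<epsilon>"
        using s by blast
    qed
  qed
qed

section \<open>The Volterra operator and its optimal domains as weighted spaces\<close>

lemma Volterra_has_field_derivative: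
  assumes "g \<in> hol_disc" "f \<in> hol_disc" "z \<in> unit_disc"
  shows "(Volterra g f has_field_derivative f z * deriv g z) (at z)"
proof -
  have "(\<lambda>z. f z * deriv g z) holomorphic_on unit_disc"
    using assms by (auto simp: hol_disc_def intro!: holomorphic_intros)
  then obtain G where G: "\<And>x. x \<in> unit_disc \<Longrightarrow>
      (G has_field_derivative f x * deriv g x) (at x within unit_disc)"
    using holomorphic_convex_primitive'[OF convex_ball open_ball] by blast
  have V: "Volterra g f x = G x - G 0" if "x \<in> unit_disc" for x
  proof -
    have "closed_segment 0 x \<subseteq> unit_disc"
      using that by (intro closed_segment_subset) auto
    then have "((\<lambda>z. f z * deriv g z) has_contour_integral G x - G 0) (linepath 0 x)"
      using contour_integral_primitive[OF G, of "linepath 0 x"] by simp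
    then show ?thesis by (simp add: Volterra_def contour_integral_unique)
  qed
  have deriv: "((\<lambda>x. G x - G 0) has_field_derivative f z * deriv g z) (at z)"
    using DERIV_diff[OF G[OF assms(3)] DERIV_const] at_within_open[OF assms(3) open_ball] by simp
  \<comment> \<open>The two functions are known to agree only on the disc, but as a neighbourhood of
    \<open>z\<close> it determines the derivative there.\<close>
  have "eventually (\<lambda>x. G x - G 0 = Volterra g f x) (nhds z)"
    using V assms(3) by (auto simp: eventually_nhds intro!: exI[of _ unit_disc])
  from DERIV_cong_ev[OF refl this refl] deriv show ?thesis by blast
qed

lemma optimal_domain_growth_space:
  assumes "g \<in> hol_disc" "\<gamma> > 0"
  shows "optimal_domain g (growth_space \<gamma>) =
    {f \<in> hol_disc. (\<lambda>z. f z * deriv g z) \<in> growth_space (\<gamma> + 1)}"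
  using growth_space_iff_deriv[OF Volterra_has_field_derivative[OF assms(1)] assms(2)]
  by (auto simp: optimal_domain_def)

lemma optimal_domain_growth_space0:
  assumes "g \<in> hol_disc" "\<gamma> > 0"
  shows "optimal_domain g (growth_space0 \<gamma>) =
    {f \<in> hol_disc. (\<lambda>z. f z * deriv g z) \<in> growth_space0 (\<gamma> + 1)}"
  using growth_space0_iff_deriv[OF Volterra_has_field_derivative[OF assms(1)] assms(2)]
  by (auto simp: optimal_domain_def)

section \<open>Unbounded functions are not multipliers\<close>

text \<open>A hands-on uniform boundedness argument. \<open>E\<close> lies in the unit ball of the
  weighted sup norm; multiplication by \<open>h\<close> sends each member of \<open>E\<close> to
  finite norm, but without a common bound. Each new term is small in norm, yet makes
  \<open>h\<close> times the partial sum large at some point, while all later terms barely disturb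
  the value there. Stating the conclusion for every pointwise sum \<open>f\<close> leaves
  convergence and holomorphy to the application.\<close>

lemma gliding_hump:
  fixes u :: "'a \<Rightarrow> real" and h :: "'a \<Rightarrow> complex" and E :: "('a \<Rightarrow> complex) set"
  assumes u0: "\<And>z. z \<in> D \<Longrightarrow> u z \<ge> 0"
    and le1: "\<And>e z. \<lbrakk>e \<in> E; z \<in> D\<rbrakk> \<Longrightarrow> u z * norm (e z) \<le> 1"
    and bdd: "\<And>e. e \<in> E \<Longrightarrow> \<exists>B. \<forall>z\<in>D. u z * norm (h z * e z) \<le> B"
    and unb: "\<And>B. \<exists>e\<in>E. \<exists>z\<in>D. u z * norm (h z * e z) > B"
  obtains e \<epsilon> where "\<And>k::nat. e k \<in> E" "\<And>k. 0 < \<epsilon> k" "\<And>k. \<epsilon> k \<le> (1 / 2) ^ k"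
    "\<And>f B. (\<And>z. z \<in> D \<Longrightarrow> (\<lambda>k. of_real (\<epsilon> k) * e k z) sums f z)
      \<Longrightarrow> \<exists>z\<in>D. u z * norm (h z * f z) > B"
proof -
  let ?bd = "\<lambda>S. \<exists>B. \<forall>z\<in>D. u z * norm (h z * S z) \<le> B"
  have step: "\<exists>e z. e \<in> E \<and> z \<in> D \<and> ?bd (\<lambda>w. S w + of_real \<delta> * e w) \<and>
      N \<le> u z * norm (h z * (S z + of_real \<delta> * e z))" if S: "?bd S" and \<delta>: "\<delta> > 0" for S \<delta> N
  proof -
    obtain B where B: "\<And>z. z \<in> D \<Longrightarrow> u z * norm (h z * S z) \<le> B" using S by blast
    \<comment> \<open>After scaling by \<delta> the new term exceeds \<open>N + B\<close> at
      \<open>z\<close>, and the old sum can cancel at most \<open>B\<close> of it.\<close>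
    obtain e z where ez: "e \<in> E" "z \<in> D" "u z * norm (h z * e z) > (N + B) / \<delta>" using unb by blast
    obtain B' where B': "\<And>z. z \<in> D \<Longrightarrow> u z * norm (h z * e z) \<le> B'" using bdd ez(1) by blast
    have split: "h w * (S w + of_real \<delta> * e w) = h w * S w + of_real \<delta> * (h w * e w)" for w
      by (simp add: algebra_simps)
    have n\<delta>: "norm (of_real \<delta> * (h w * e w)) = \<delta> * norm (h w * e w)" for w
      using \<delta> by (simp add: norm_mult)
    have "u w * norm (h w * (S w + of_real \<delta> * e w)) \<le> B + \<delta> * B'" if w: "w \<in> D" for w
    proof -
      have "u w * norm (h w * (S w + of_real \<delta> * e w)) \<le> u w * (norm (h w * S w) + \<delta> * norm (h w * e w))"
        unfolding split using norm_triangle_ineq n\<delta> u0[OF w] by (metis mult_left_mono)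
      also have "\<dots> = u w * norm (h w * S w) + \<delta> * (u w * norm (h w * e w))"
        by (simp add: algebra_simps)
      also have "\<dots> \<le> B + \<delta> * B'"
        using B B' w \<delta> by (intro add_mono mult_left_mono) auto
      finally show ?thesis .
    qed
    moreover have "N \<le> u z * norm (h z * (S z + of_real \<delta> * e z))"
    proof -
      have "N + B \<le> \<delta> * (u z * norm (h z * e z))"
        using ez(3) \<delta> by (simp add: field_simps)
      then have "N \<le> \<delta> * (u z * norm (h z * e z)) - u z * norm (h z * S z)"
        using B[OF ez(2)] by simp
      also have "\<dots> = u z * (\<delta> * norm (h z * e z) - norm (h z * S z))"
        by (simp add: algebra_simps)
      also have "\<dots> \<le> u z * norm (h z * (S z + of_real \<delta> * e z))"
        unfolding split using norm_diff_ineq[of "of_real \<delta> * (h z * e z)" "h z * S z"] n\<delta>[of z] u0[OF ez(2)]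
        by (intro mult_left_mono) (simp_all add: add.commute)
      finally show ?thesis .
    qed
    ultimately show ?thesis using ez by blast
  qed
  \<comment> \<open>\<open>S\<close> is the partial sum up to the current term. The bound on \<open>\<epsilon>'\<close> in \<open>Q\<close> ensures that all later
    terms together change the value of \<open>u h S\<close> at the current point \<open>z\<close> by at most 1.\<close>
  define P where "P = (\<lambda>k (S, \<epsilon>, e, z). e \<in> E \<and> z \<in> D \<and> 0 < \<epsilon> \<and> \<epsilon> \<le> (1 / 2) ^ k \<and> ?bd S \<and>
      real k \<le> u z * norm (h z * S z) \<and> (k = 0 \<longrightarrow> S = (\<lambda>w. of_real \<epsilon> * e w)))"
  define Q where "Q = (\<lambda>(S, \<epsilon>, e :: 'a \<Rightarrow> complex, z :: 'a) (S' :: 'a \<Rightarrow> complex, \<epsilon>' :: real, e', z' :: 'a).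
      S' = (\<lambda>w. S w + of_real \<epsilon>' * e' w) \<and> \<epsilon>' * (1 + norm (h z)) \<le> \<epsilon> / 2)"
  have "\<exists>s. \<forall>k. P k (s k) \<and> Q (s k) (s (Suc k))"
  proof (rule dependent_nat_choice)
    have "?bd (\<lambda>_. 0)" by (rule exI[of _ 0]) simp
    from step[OF this zero_less_one, of 0] obtain e z where "e \<in> E" "z \<in> D"
      "?bd (\<lambda>w. 0 + of_real 1 * e w)" "0 \<le> u z * norm (h z * (0 + of_real 1 * e z))"
      by blast
    then have "P 0 (\<lambda>w. of_real 1 * e w, 1, e, z)" by (simp add: P_def)
    then show "\<exists>x. P 0 x" by blast
  next
    fix x k assume "P k x"
    moreover obtain S \<epsilon> e z where x: "x = (S, \<epsilon>, e, z)" by (cases x)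
    ultimately have p: "?bd S" "0 < \<epsilon>" "\<epsilon> \<le> (1 / 2) ^ k" by (auto simp: P_def)
    \<comment> \<open>The factor |h z| in the denominator gives the smallness demanded by
      \<open>Q\<close>; the summand 1 makes \<delta> at most \<epsilon>/2, whence the geometric
      decay.\<close>
    define \<delta> where "\<delta> = \<epsilon> / 2 / (1 + norm (h z))"
    have pos: "1 + norm (h z) > 0" by (simp add: add_pos_nonneg)
    have \<delta>: "\<delta> > 0" "\<delta> * (1 + norm (h z)) = \<epsilon> / 2"
      unfolding \<delta>_def using p pos by (simp, metis nonzero_eq_divide_eq less_irrefl)
    have "\<delta> \<le> \<delta> * (1 + norm (h z))" using \<delta>(1) by simp
    then have "\<delta> \<le> (1 / 2) ^ Suc k" using \<delta>(2) p(3) by simp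
    moreover obtain e' z' where "e' \<in> E" "z' \<in> D" "?bd (\<lambda>w. S w + of_real \<delta> * e' w)"
      "real (Suc k) \<le> u z' * norm (h z' * (S z' + of_real \<delta> * e' z'))"
      using step[OF p(1) \<delta>(1), of "real (Suc k)"] by blast
    ultimately have "P (Suc k) (\<lambda>w. S w + of_real \<delta> * e' w, \<delta>, e', z')"
      "Q x (\<lambda>w. S w + of_real \<delta> * e' w, \<delta>, e', z')"
      using \<delta> unfolding x by (simp_all add: P_def Q_def)
    then show "\<exists>y. P (Suc k) y \<and> Q x y" by blast
  qed
  then obtain s where s: "\<And>k. P k (s k)" "\<And>k. Q (s k) (s (Suc k))" by blast
  define S \<epsilon> e z where "S = (\<lambda>k. fst (s k))" and "\<epsilon> = (\<lambda>k. fst (snd (s k)))"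
    and "e = (\<lambda>k. fst (snd (snd (s k))))" and "z = (\<lambda>k. snd (snd (snd (s k))))"
  have s_eq: "s k = (S k, \<epsilon> k, e k, z k)" for k by (simp add: S_def \<epsilon>_def e_def z_def)
  have e: "e k \<in> E" and z: "z k \<in> D" and \<epsilon>: "0 < \<epsilon> k" "\<epsilon> k \<le> (1 / 2) ^ k"
    and large: "real k \<le> u (z k) * norm (h (z k) * S k (z k))"
    and S0: "S 0 = (\<lambda>w. of_real (\<epsilon> 0) * e 0 w)" for k
    using s(1)[of k] s(1)[of 0] by (simp_all add: s_eq P_def Q_def)
  have SS: "S (Suc k) = (\<lambda>w. S k w + of_real (\<epsilon> (Suc k)) * e (Suc k) w)"
    and small: "\<epsilon> (Suc k) * (1 + norm (h (z k))) \<le> \<epsilon> k / 2" for k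
    using s(2)[of k] by (simp_all add: s_eq P_def Q_def)
  \<comment> \<open>\<open>S k\<close> contains the term of index \<open>k\<close>, so the tail
    estimated below starts at \<open>Suc k\<close>.\<close>
  have S_sum: "S k w = (\<Sum>i<Suc k. of_real (\<epsilon> i) * e i w)" for k w
    by (induction k) (simp_all add: S0 SS)
  have half: "\<epsilon> (Suc k) \<le> \<epsilon> k / 2" for k
  proof -
    have "\<epsilon> (Suc k) * 1 \<le> \<epsilon> (Suc k) * (1 + norm (h (z k)))"
      using \<epsilon>(1)[of "Suc k"] by (intro mult_left_mono) auto
    with small[of k] show ?thesis by simp
  qed
  have geo: "\<epsilon> (i + k) \<le> \<epsilon> k * (1 / 2) ^ i" for i k
  proof (induction i)
    case (Suc i)
    then show ?case using half[of "i + k"] by simp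
  qed simp
  have "\<exists>w\<in>D. u w * norm (h w * f w) > B"
    if f: "\<And>w. w \<in> D \<Longrightarrow> (\<lambda>k. of_real (\<epsilon> k) * e k w) sums f w" for f B
  proof -
    \<comment> \<open>At the \<open>k\<close>-th point the partial sum reaches at least
      \<open>k\<close>; the 1 is reserved for the tail.\<close>
    obtain k :: nat where k: "real k > B + 1" using reals_Archimedean2 by blast
    define w where "w = z k"
    have w: "w \<in> D" using z by (simp add: w_def)
    have "(\<lambda>i. of_real (\<epsilon> (i + Suc k)) * e (i + Suc k) w) sums (f w - S k w)"
      using f[OF w] by (subst sums_iff_shift) (simp add: S_sum)
    then have "(\<lambda>i. of_real (u w) * h w * (of_real (\<epsilon> (i + Suc k)) * e (i + Suc k) w)) sums
        (of_real (u w) * h w * (f w - S k w))"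
      by (rule sums_mult)
    \<comment> \<open>By \<open>le1\<close> and the geometric decay the tail terms are at most |h w|
      \<open>\<epsilon> (Suc k)\<close> / 2^i, and \<open>small\<close> bounds |h w|
      \<open>\<epsilon> (Suc k)\<close> by 1/2. The resulting majorant is the series of 1/2^(i+1),
      with sum 1.\<close>
    then have "norm (of_real (u w) * h w * (f w - S k w)) \<le> 1"
    proof (rule norm_sums_le[OF _ power_half_series])
      fix i
      have "norm (of_real (u w) * h w * (of_real (\<epsilon> (i + Suc k)) * e (i + Suc k) w)) =
          norm (h w) * \<epsilon> (i + Suc k) * (u w * norm (e (i + Suc k) w))"
        using \<epsilon>(1)[of "i + Suc k"] u0[OF w] by (simp add: norm_mult)
      also have "\<dots> \<le> norm (h w) * \<epsilon> (i + Suc k)"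
        using le1[OF e w, of "i + Suc k"] \<epsilon>(1)[of "i + Suc k"] by (intro mult_right_le_one_le) (auto simp: u0 w)
      also have "\<dots> \<le> norm (h w) * (\<epsilon> (Suc k) * (1 / 2) ^ i)"
        by (intro mult_left_mono geo) simp
      also have "\<dots> \<le> 1 / 2 * (1 / 2) ^ i"
      proof -
        have "norm (h w) * \<epsilon> (Suc k) \<le> \<epsilon> k / 2"
          using small[of k] \<epsilon>(1)[of "Suc k"] by (simp add: w_def algebra_simps)
        also have "\<dots> \<le> 1 / 2"
          using \<epsilon>(2)[of k] power_le_one[of "1 / 2 :: real" k] by simp
        finally show ?thesis
          using mult_right_mono[of "norm (h w) * \<epsilon> (Suc k)" "1 / 2" "(1 / 2) ^ i"] by (simp add: mult.assoc)
      qed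
      finally show "norm (of_real (u w) * h w * (of_real (\<epsilon> (i + Suc k)) * e (i + Suc k) w)) \<le> (1 / 2) ^ Suc i"
        by simp
    qed
    then have 1: "u w * norm (h w * (f w - S k w)) \<le> 1"
      using u0[OF w] by (simp add: norm_mult mult.assoc)
    have "h w * S k w = h w * f w - h w * (f w - S k w)" by (simp add: algebra_simps)
    then have "norm (h w * S k w) \<le> norm (h w * f w) + norm (h w * (f w - S k w))"
      by (metis norm_triangle_ineq4)
    from mult_left_mono[OF this u0[OF w]]
    have "real k \<le> u w * norm (h w * f w) + 1"
      using large[of k] 1 by (simp add: w_def distrib_left)
    with k w show ?thesis by (intro bexI[of _ w]) auto
  qed
  with e \<epsilon> show ?thesis by (rule that)
qed

lemma bounded_image_if_bounded_on_dense:
  fixes h :: "'a::metric_space \<Rightarrow> 'b::real_normed_vector"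
  assumes S: "open S" "continuous_on S h" and A: "S \<subseteq> closure A" and M: "\<And>z. z \<in> A \<Longrightarrow> norm (h z) \<le> M"
  shows "bounded (h ` S)"
proof -
  have "norm (h z) \<le> M" if z: "z \<in> S" for z
  proof -
    obtain x where x: "\<And>n. x n \<in> A" "x \<longlonglongrightarrow> z"
      using subsetD[OF A z] unfolding closure_sequential by blast
    have "isCont h z" using S z by (simp add: continuous_on_eq_continuous_at)
    then have "(\<lambda>n. h (x n)) \<longlonglongrightarrow> h z" using x(2) by (rule isCont_tendsto_compose)
    then show ?thesis using x(1) M by (intro Lim_norm_ubound) auto
  qed
  then show ?thesis by (auto simp: bounded_iff)
qed

text \<open>The properties required of \<open>X\<close> are common to the O- and o-versions of the
  optimal domain. As \<open>X\<close> contains 1, it contains all powers of a multiplier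
  \<open>h\<close>; \<open>closed\<close> admits into \<open>X\<close> the norm limit built from
  them by \<open>gliding_hump\<close>, although \<open>h\<close> times this limit has infinite
  norm.\<close>

lemma multiplier_of_weighted_space_bounded:
  fixes u :: "complex \<Rightarrow> real"
  assumes u0: "\<And>z. z \<in> unit_disc \<Longrightarrow> u z \<ge> 0"
    and dense: "unit_disc \<subseteq> closure {z \<in> unit_disc. u z > 0}"
    and add: "\<And>f k. \<lbrakk>f \<in> X; k \<in> X\<rbrakk> \<Longrightarrow> (\<lambda>z. f z + k z) \<in> X"
    and scale: "\<And>c f. f \<in> X \<Longrightarrow> (\<lambda>z. c * f z) \<in> X"
    and one: "(\<lambda>z. 1) \<in> X"
    and bdd: "\<And>f. f \<in> X \<Longrightarrow> \<exists>B. \<forall>z\<in>unit_disc. u z * norm (f z) \<le> B"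
    and closed: "\<And>f. \<lbrakk>f \<in> hol_disc; \<And>\<delta>. \<delta> > 0 \<Longrightarrow> \<exists>p\<in>X. \<forall>z\<in>unit_disc. u z * norm (f z - p z) \<le> \<delta>\<rbrakk>
      \<Longrightarrow> f \<in> X"
    and h: "h \<in> multipliers X"
  shows "h \<in> H_infty"
proof (rule ccontr)
  assume "h \<notin> H_infty"
  have hol: "h holomorphic_on unit_disc" and mult: "\<And>f. f \<in> X \<Longrightarrow> (\<lambda>z. h z * f z) \<in> X"
    using h by (auto simp: multipliers_def hol_disc_def)
  have cont: "continuous_on unit_disc h" using hol by (rule holomorphic_on_imp_continuous_on)
  have unbdd: "\<not> bounded (h ` unit_disc)" using \<open>h \<notin> H_infty\<close> hol by (simp add: H_infty_def hol_disc_def)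
  \<comment> \<open>Points where the weight vanishes carry no information about norms. By density
    and continuity, \<open>h\<close> is unbounded already where \<open>u\<close> is
    positive.\<close>
  have large: "\<exists>z\<in>unit_disc. u z > 0 \<and> norm (h z) > M" for M
  proof (rule ccontr)
    assume "\<not> ?thesis"
    then have "\<And>z. z \<in> {z \<in> unit_disc. u z > 0} \<Longrightarrow> norm (h z) \<le> M"
      by (metis (mono_tags, lifting) mem_Collect_eq not_less)
    from bounded_image_if_bounded_on_dense[OF open_ball cont dense this]
    show False using unbdd by simp
  qed
  have pow: "(\<lambda>z. h z ^ n) \<in> X" for n
    by (induction n) (use one mult in auto)
  define b where "b n = (SUP z\<in>unit_disc. u z * norm (h z) ^ n)" for n
  have bdd_b: "bdd_above ((\<lambda>z. u z * norm (h z) ^ n) ` unit_disc)" for n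
    using bdd[OF pow[of n]] by (auto simp: bdd_above_def norm_power)
  have b: "u z * norm (h z) ^ n \<le> b n" if "z \<in> unit_disc" for n z
    unfolding b_def by (rule cSUP_upper[OF that bdd_b])
  have b_pos: "b n > 0" for n
  proof -
    obtain z where z: "z \<in> unit_disc" "u z > 0" "norm (h z) > 0" using large by blast
    then have "0 < u z * norm (h z) ^ n" by simp
    also have "\<dots> \<le> b n" using z b by blast
    finally show ?thesis .
  qed
  \<comment> \<open>The powers of \<open>h\<close>, normalized to weighted norm 1.\<close>
  define E where "E = range (\<lambda>n z. h z ^ n / of_real (b n))"
  have E_X: "e \<in> X" if "e \<in> E" for e
    using that scale[OF pow, of "inverse (of_real (b n))" for n] by (auto simp: E_def field_simps)
  have norm_e: "norm (h z ^ n / of_real (b n)) = norm (h z) ^ n / b n" for z n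
    using b_pos[of n] by (simp add: norm_divide norm_power)
  obtain e \<epsilon> where e: "\<And>k::nat. e k \<in> E" and \<epsilon>: "\<And>k. 0 < \<epsilon> k" "\<And>k. \<epsilon> k \<le> (1 / 2) ^ k"
    and unb: "\<And>f B. (\<And>z. z \<in> unit_disc \<Longrightarrow> (\<lambda>k. of_real (\<epsilon> k) * e k z) sums f z)
      \<Longrightarrow> \<exists>z\<in>unit_disc. u z * norm (h z * f z) > B"
  proof (rule gliding_hump[of unit_disc u E h])
    show "u z * norm (e z) \<le> 1" if "e \<in> E" "z \<in> unit_disc" for e z
      using that b b_pos by (auto simp: E_def norm_e)
    show "\<exists>B. \<forall>z\<in>unit_disc. u z * norm (h z * e z) \<le> B" if "e \<in> E" for e
      using bdd[OF mult[OF E_X[OF that]]] .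
    show "\<exists>e\<in>E. \<exists>z\<in>unit_disc. B < u z * norm (h z * e z)" for B
    proof (rule ccontr)
      \<comment> \<open>A common bound would give \<open>b (Suc n) \<le> M * b n\<close>, hence
        \<open>u z * norm (h z) ^ n \<le> M ^ n * b 0\<close> for all \<open>n\<close>. This fails
        at a point with \<open>u z > 0\<close> and |h z| > \<open>M\<close>. The maximum with 1
        keeps \<open>M\<close> positive.\<close>
      define M where "M = max B 1"
      assume *: "\<not> ?thesis"
      have le_M: "u z * norm (h z * (h z ^ n / of_real (b n))) \<le> M" if "z \<in> unit_disc" for z n
      proof -
        have "(\<lambda>z. h z ^ n / of_real (b n)) \<in> E" by (simp add: E_def)
        with * that have "u z * norm (h z * (h z ^ n / of_real (b n))) \<le> B" by (meson not_less)
        then show ?thesis by (simp add: M_def)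
      qed
      have "u z * norm (h z) ^ Suc n \<le> M * b n" if "z \<in> unit_disc" for z n
        using le_M[OF that, of n] b_pos[of n] by (simp only: norm_mult norm_e) (simp add: field_simps)
      then have b_Suc: "b (Suc n) \<le> M * b n" for n
        unfolding b_def[of "Suc n"] by (intro cSUP_least) auto
      have b_le: "b n \<le> M ^ n * b 0" for n
      proof (induction n)
        case (Suc n)
        have "M * b n \<le> M * (M ^ n * b 0)" using Suc by (intro mult_left_mono) (auto simp: M_def)
        with b_Suc[of n] show ?case by (simp add: mult.assoc)
      qed simp
      obtain z where z: "z \<in> unit_disc" "u z > 0" "norm (h z) > M" using large by blast
      have M0: "M > 0" by (simp add: M_def)
      then have "norm (h z) / M > 1" using z by simp
      then obtain n where n: "(norm (h z) / M) ^ n > b 0 / u z" using real_arch_pow by blast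
      have "u z * norm (h z) ^ n \<le> M ^ n * b 0" using b[OF z(1), of n] b_le[of n] by simp
      with n show False using z M0 by (simp add: power_divide field_simps)
    qed
  qed (use u0 in auto)
  define f where "f z = (\<Sum>k. of_real (\<epsilon> k) * e k z)" for z
  \<comment> \<open>If \<open>|h| < |h w|\<close> on \<open>K\<close>, then \<open>u w |h w|\<^sup>n \<le> b n\<close> bounds every \<open>h\<^sup>n / b n\<close> there by \<open>1 / u w\<close>.\<close>
  have local: "\<exists>C. \<forall>k. \<forall>z\<in>K. norm (e k z) \<le> C" if K: "compact K" "K \<subseteq> unit_disc" for K
  proof -
    have "bounded (h ` K)"
      using K cont by (intro compact_imp_bounded compact_continuous_image) (auto intro: continuous_on_subset)
    then obtain R where R: "\<And>z. z \<in> K \<Longrightarrow> norm (h z) \<le> R" by (auto simp: bounded_iff)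
    obtain w where w: "w \<in> unit_disc" "u w > 0" "norm (h w) > R" using large by blast
    have "norm (h z ^ n / of_real (b n)) \<le> 1 / u w" if "z \<in> K" for z n
    proof -
      have "norm (h z) ^ n \<le> norm (h w) ^ n" using R[OF that] w by (intro power_mono) auto
      then have "u w * norm (h z) ^ n \<le> b n"
        using b[OF w(1), of n] w(2) by (meson mult_left_mono less_imp_le order_trans)
      then show ?thesis unfolding norm_e using w b_pos[of n] by (simp add: field_simps)
    qed
    then show ?thesis using e by (metis (no_types, lifting) E_def imageE)
  qed
  \<comment> \<open>Convergence in the weighted norm says nothing at zeros of \<open>u\<close>, so
    holomorphy of \<open>f\<close> is derived from unweighted uniform convergence on compact
    sets.\<close>
  have unif: "uniform_limit K (\<lambda>n z. \<Sum>k<n. of_real (\<epsilon> k) * e k z) f sequentially"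
    if K: "compact K" "K \<subseteq> unit_disc" for K
  proof -
    obtain C where C: "\<And>k z. z \<in> K \<Longrightarrow> norm (e k z) \<le> C" using local[OF K] by blast
    show ?thesis unfolding f_def
    proof (rule Weierstrass_m_test)
      show "norm (of_real (\<epsilon> k) * e k z) \<le> (1 / 2) ^ k * C" if "z \<in> K" for k z
        using \<epsilon>[of k] C[OF that, of k] by (auto simp: norm_mult intro!: mult_mono)
      show "summable (\<lambda>k. (1 / 2 :: real) ^ k * C)" by (intro summable_mult2 summable_geometric) simp
    qed
  qed
  have sums: "(\<lambda>k. of_real (\<epsilon> k) * e k z) sums f z" if "z \<in> unit_disc" for z
    using tendsto_uniform_limitI[OF unif[of "{z}"], of z] that by (simp add: sums_def)
  have part_X: "(\<lambda>z. \<Sum>k<n. of_real (\<epsilon> k) * e k z) \<in> X" for n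
  proof (induction n)
    case 0
    show ?case using scale[OF one, of 0] by simp
  next
    case (Suc n)
    then show ?case using add[OF _ scale[OF E_X[OF e]]] by simp
  qed
  have "f \<in> X"
  proof (rule closed)
    have "(\<lambda>z. \<Sum>k<n. of_real (\<epsilon> k) * e k z) holomorphic_on unit_disc" for n
    proof (intro holomorphic_intros)
      fix k
      show "e k holomorphic_on unit_disc"
        using e[of k] hol b_pos by (auto simp: E_def intro!: holomorphic_intros)
    qed
    then have "f holomorphic_on unit_disc"
    proof (rule holomorphic_uniform_sequence[OF open_ball])
      fix x :: complex assume "x \<in> unit_disc"
      then obtain d where d: "d > 0" "cball x d \<subseteq> unit_disc"
        using open_contains_cball[of unit_disc] open_ball by blast
      then show "\<exists>d>0. cball x d \<subseteq> unit_disc \<and>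
          uniform_limit (cball x d) (\<lambda>n z. \<Sum>k<n. of_real (\<epsilon> k) * e k z) f sequentially"
        using unif[OF compact_cball] by blast
    qed
    then show "f \<in> hol_disc" by (simp add: hol_disc_def)
    fix \<delta> :: real assume \<delta>: "\<delta> > 0"
    \<comment> \<open>The tail from index \<open>n\<close> on has weighted norm at most
      2/2^n.\<close>
    obtain n where n: "(1 / 2 :: real) ^ n < \<delta> / 2" using real_arch_pow_inv[of "\<delta> / 2" "1 / 2"] \<delta> by auto
    have "u z * norm (f z - (\<Sum>k<n. of_real (\<epsilon> k) * e k z)) \<le> \<delta>" if z: "z \<in> unit_disc" for z
    proof -
      have "(\<lambda>i. of_real (\<epsilon> (i + n)) * e (i + n) z) sums (f z - (\<Sum>k<n. of_real (\<epsilon> k) * e k z))"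
        using sums[OF z] by (subst sums_iff_shift) simp
      then have "(\<lambda>i. of_real (u z) * (of_real (\<epsilon> (i + n)) * e (i + n) z)) sums
          (of_real (u z) * (f z - (\<Sum>k<n. of_real (\<epsilon> k) * e k z)))"
        by (rule sums_mult)
      moreover have "(\<lambda>i. (1 / 2) ^ n * (1 / 2 :: real) ^ i) sums ((1 / 2) ^ n * (1 / (1 - 1 / 2)))"
        by (intro sums_mult geometric_sums) simp
      moreover have "norm (of_real (u z) * (of_real (\<epsilon> (i + n)) * e (i + n) z)) \<le> (1 / 2) ^ n * (1 / 2) ^ i" for i
      proof -
        obtain m where m: "e (i + n) = (\<lambda>z. h z ^ m / of_real (b m))" using e[of "i + n"] by (auto simp: E_def)
        have "u z * norm (e (i + n) z) \<le> 1"
          using b[OF z, of m] b_pos[of m] unfolding m norm_e by simp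
        then have "\<epsilon> (i + n) * (u z * norm (e (i + n) z)) \<le> (1 / 2) ^ (i + n) * 1"
          using \<epsilon>[of "i + n"] u0[OF z] by (intro mult_mono) auto
        then show ?thesis using \<epsilon>(1)[of "i + n"] u0[OF z]
          by (simp add: norm_mult power_add mult_ac)
      qed
      ultimately have "norm (of_real (u z) * (f z - (\<Sum>k<n. of_real (\<epsilon> k) * e k z))) \<le> (1 / 2) ^ n * (1 / (1 - 1 / 2))"
        by (rule norm_sums_le)
      then show ?thesis using n u0[OF z] by (simp add: norm_mult)
    qed
    then show "\<exists>p\<in>X. \<forall>z\<in>unit_disc. u z * norm (f z - p z) \<le> \<delta>"
      using part_X by (intro bexI[of _ "\<lambda>z. \<Sum>k<n. of_real (\<epsilon> k) * e k z"]) auto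
  qed
  then show False using bdd[OF mult] unb[OF sums] by (meson not_less)
qed

section \<open>The multiplier spaces\<close>

text \<open>Otherwise \<open>deriv g\<close> would vanish on a nonempty open set, hence on the whole
  disc by the identity theorem, and \<open>g\<close> would be constant.\<close>

lemma deriv_nonzero_dense:
  assumes g: "g \<in> hol_disc" "\<not> g constant_on unit_disc"
  shows "unit_disc \<subseteq> closure {z \<in> unit_disc. deriv g z \<noteq> 0}"
proof
  fix z :: complex assume z: "z \<in> unit_disc"
  have hol: "g holomorphic_on unit_disc" using g by (simp add: hol_disc_def)
  show "z \<in> closure {z \<in> unit_disc. deriv g z \<noteq> 0}"
  proof (rule ccontr)
    assume z_notin: "\<not> ?thesis"
    define U where "U = unit_disc - closure {z \<in> unit_disc. deriv g z \<noteq> 0}"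
    have U: "open U" "z \<in> U" "U \<subseteq> unit_disc" using z_notin z by (auto simp: U_def)
    have "deriv g w = 0" if "w \<in> U" for w
      using that closure_subset[of "{z \<in> unit_disc. deriv g z \<noteq> 0}"] by (auto simp: U_def)
    with U have "deriv g w = 0" if "w \<in> unit_disc" for w
      using that analytic_continuation_open[of U unit_disc "deriv g" "\<lambda>_. 0" w]
        holomorphic_deriv[OF hol open_ball] by auto
    then have "(g has_field_derivative 0) (at w within unit_disc)" if "w \<in> unit_disc" for w
      using that holomorphic_derivI[OF hol open_ball that] by simp
    then obtain c where "\<And>w. w \<in> unit_disc \<Longrightarrow> g w = c"
      using has_field_derivative_zero_constant[OF convex_ball, of 0 1 g] by blast
    then show False using g(2) by (auto simp: constant_on_def)
  qed
qed

section \<open>Closure properties of the growth spaces\<close>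

lemma bounded_multiplier_growth_space:
  assumes "h \<in> H_infty" "\<phi> \<in> growth_space \<gamma>"
  shows "(\<lambda>z. h z * \<phi> z) \<in> growth_space \<gamma>"
proof -
  obtain M where "\<forall>z\<in>unit_disc. norm (h z) \<le> M"
    using assms(1) by (auto simp: H_infty_def bounded_iff)
  then have M: "\<And>z. norm z < 1 \<Longrightarrow> norm (h z) \<le> M" by simp
  obtain c where c: "\<And>z. norm z < 1 \<Longrightarrow> (1 - norm z) powr \<gamma> * norm (\<phi> z) \<le> c"
    using assms(2) unfolding growth_space_iff by blast
  have "(1 - norm z) powr \<gamma> * norm (h z * \<phi> z) \<le> M * c" if "norm z < 1" for z
  proof -
    have "norm (h z) * ((1 - norm z) powr \<gamma> * norm (\<phi> z)) \<le> M * c"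
      using M[OF that] c[OF that] order_trans[OF norm_ge_zero M[OF that]] by (intro mult_mono) auto
    then show ?thesis by (simp add: norm_mult mult_ac)
  qed
  then show ?thesis using assms
    by (auto simp: growth_space_iff H_infty_def hol_disc_def intro!: holomorphic_intros)
qed

lemma bounded_multiplier_growth_space0:
  assumes "h \<in> H_infty" "\<phi> \<in> growth_space0 \<gamma>"
  shows "(\<lambda>z. h z * \<phi> z) \<in> growth_space0 \<gamma>"
proof -
  obtain M where "M > 0" "\<forall>z\<in>unit_disc. norm (h z) \<le> M"
    using assms(1) by (auto simp: H_infty_def bounded_pos)
  then have M: "M > 0" "\<And>z. norm z < 1 \<Longrightarrow> norm (h z) \<le> M" by simp_all
  have "\<exists>r<1. \<forall>z. r < norm z \<longrightarrow> norm z < 1 \<longrightarrow> (1 - norm z) powr \<gamma> * norm (h z * \<phi> z) < \<epsilon>"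
    if "\<epsilon> > 0" for \<epsilon>
  proof -
    have "\<epsilon> / M > 0" using that M by simp
    then obtain r where r: "r < 1"
      "\<And>z. r < norm z \<Longrightarrow> norm z < 1 \<Longrightarrow> (1 - norm z) powr \<gamma> * norm (\<phi> z) < \<epsilon> / M"
      using assms(2) unfolding growth_space0_iff by blast
    have "(1 - norm z) powr \<gamma> * norm (h z * \<phi> z) < \<epsilon>" if z: "r < norm z" "norm z < 1" for z
    proof -
      have "norm (h z) * ((1 - norm z) powr \<gamma> * norm (\<phi> z)) \<le> M * ((1 - norm z) powr \<gamma> * norm (\<phi> z))"
        using M z by (intro mult_right_mono) auto
      also have "\<dots> < \<epsilon>" using r(2)[OF z] M(1) by (simp add: field_simps)
      finally show ?thesis by (simp add: norm_mult mult_ac)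
    qed
    with r show ?thesis by blast
  qed
  then show ?thesis using assms
    by (auto simp: growth_space0_iff H_infty_def hol_disc_def intro!: holomorphic_intros)
qed

lemma growth_space0_subset: "growth_space0 \<gamma> \<subseteq> growth_space \<gamma>"
proof
  fix \<phi> assume \<phi>: "\<phi> \<in> growth_space0 \<gamma>"
  then have hol: "\<phi> holomorphic_on unit_disc" by (simp add: growth_space0_iff)
  obtain r where r: "r < 1" "\<And>z. r < norm z \<Longrightarrow> norm z < 1 \<Longrightarrow> (1 - norm z) powr \<gamma> * norm (\<phi> z) < 1"
    using \<phi> unfolding growth_space0_iff by (meson zero_less_one)
  have "compact ((\<lambda>z. (1 - norm z) powr \<gamma> * norm (\<phi> z)) ` cball 0 r)"
    using r hol by (intro compact_continuous_image continuous_intros holomorphic_on_imp_continuous_on)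
      (auto intro: holomorphic_on_subset)
  then obtain B where B: "\<And>z. norm z \<le> r \<Longrightarrow> (1 - norm z) powr \<gamma> * norm (\<phi> z) \<le> B"
    using compact_imp_bounded bounded_imp_bdd_above by (fastforce simp: bdd_above_def)
  have "(1 - norm z) powr \<gamma> * norm (\<phi> z) \<le> max 1 B" if "norm z < 1" for z
    using r(2)[of z] B[of z] that by (cases "norm z \<le> r") (auto simp: max_def)
  then show "\<phi> \<in> growth_space \<gamma>" using hol unfolding growth_space_iff by blast
qed

text \<open>The Bloch condition bounds (1 - |z|) |g'(z)|, and the remaining factor
  \<open>(1 - norm z) powr \<gamma>\<close> tends to 0. This puts the constant function 1 into both
  optimal domains.\<close>

lemma Bloch_deriv_in_growth_space0:
  assumes "g \<in> Bloch" "\<gamma> > 0"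
  shows "deriv g \<in> growth_space0 (\<gamma> + 1)"
  unfolding growth_space0_iff
proof (intro conjI allI impI)
  show "deriv g holomorphic_on unit_disc"
    using assms by (auto simp: Bloch_def hol_disc_def intro: holomorphic_deriv)
  fix \<epsilon> :: real assume \<epsilon>: "\<epsilon> > 0"
  obtain M where "\<forall>z\<in>unit_disc. (1 - norm z) * norm (deriv g z) \<le> M"
    using assms(1) by (auto simp: Bloch_def bdd_above_def)
  then have M: "\<And>z. norm z < 1 \<Longrightarrow> (1 - norm z) * norm (deriv g z) \<le> M" by simp
  define N where "N = max M 1"
  have N: "N > 0" "M \<le> N" by (auto simp: N_def)
  \<comment> \<open>The solution of \<open>(1 - r) powr \<gamma> * N = \<epsilon>\<close>.\<close>
  define r where "r = 1 - (\<epsilon> / N) powr (1 / \<gamma>)"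
  have "(1 - norm z) powr (\<gamma> + 1) * norm (deriv g z) < \<epsilon>" if z: "r < norm z" "norm z < 1" for z
  proof -
    have "(1 - norm z) powr \<gamma> < ((\<epsilon> / N) powr (1 / \<gamma>)) powr \<gamma>"
      using z assms(2) by (intro powr_less_mono2) (auto simp: r_def)
    then have *: "(1 - norm z) powr \<gamma> * N < \<epsilon>"
      using assms(2) \<epsilon> N by (simp add: powr_powr field_simps)
    have "(1 - norm z) powr (\<gamma> + 1) * norm (deriv g z) =
        (1 - norm z) powr \<gamma> * ((1 - norm z) * norm (deriv g z))"
      using z by (simp add: powr_add)
    also have "\<dots> \<le> (1 - norm z) powr \<gamma> * N"
      using M[OF z(2)] N by (intro mult_left_mono) auto
    finally show ?thesis using * by simp
  qed
  moreover have "r < 1" using \<epsilon> N by (simp add: r_def)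
  ultimately show "\<exists>r<1. \<forall>z. r < norm z \<longrightarrow> norm z < 1 \<longrightarrow> (1 - norm z) powr (\<gamma> + 1) * norm (deriv g z) < \<epsilon>"
    by blast
qed

lemma growth_space_add:
  assumes "\<phi> \<in> growth_space \<gamma>" "\<psi> \<in> growth_space \<gamma>"
  shows "(\<lambda>z. \<phi> z + \<psi> z) \<in> growth_space \<gamma>"
proof -
  obtain c d where cd: "\<And>z. norm z < 1 \<Longrightarrow> (1 - norm z) powr \<gamma> * norm (\<phi> z) \<le> c"
    "\<And>z. norm z < 1 \<Longrightarrow> (1 - norm z) powr \<gamma> * norm (\<psi> z) \<le> d"
    using assms unfolding growth_space_iff by blast
  have "(1 - norm z) powr \<gamma> * norm (\<phi> z + \<psi> z) \<le> c + d" if "norm z < 1" for z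
    using cd[OF that] mult_left_mono[OF norm_triangle_ineq[of "\<phi> z" "\<psi> z"] powr_ge_zero[of "1 - norm z" \<gamma>]]
    by (simp add: distrib_left)
  then show ?thesis using assms by (auto simp: growth_space_iff intro!: holomorphic_intros)
qed

lemma growth_space0_add:
  assumes "\<phi> \<in> growth_space0 \<gamma>" "\<psi> \<in> growth_space0 \<gamma>"
  shows "(\<lambda>z. \<phi> z + \<psi> z) \<in> growth_space0 \<gamma>"
proof -
  have lim: "((\<lambda>z. (1 - norm z) powr \<gamma> * norm (\<phi> z) + (1 - norm z) powr \<gamma> * norm (\<psi> z)) \<longlongrightarrow> 0)
      (filtercomap norm (at_left 1))"
    using assms unfolding growth_space0_def by (intro tendsto_add_zero) auto
  have "((\<lambda>z. (1 - norm z) powr \<gamma> * norm (\<phi> z + \<psi> z)) \<longlongrightarrow> 0) (filtercomap norm (at_left 1))"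
    by (rule tendsto_sandwich[OF _ _ tendsto_const lim])
      (auto intro!: always_eventually mult_left_mono norm_triangle_ineq simp flip: distrib_left)
  then show ?thesis using assms
    by (auto simp: growth_space0_def hol_disc_def intro!: holomorphic_intros)
qed

lemma constant_in_H_infty: "(\<lambda>_. c) \<in> H_infty"
  by (auto simp: H_infty_def hol_disc_def bounded_iff)

lemma growth_space0_closed:
  assumes hol: "\<phi> holomorphic_on unit_disc"
    and approx: "\<And>\<delta>. \<delta> > 0 \<Longrightarrow> \<exists>\<psi>\<in>growth_space0 \<gamma>. \<forall>z\<in>unit_disc. (1 - norm z) powr \<gamma> * norm (\<phi> z - \<psi> z) \<le> \<delta>"
  shows "\<phi> \<in> growth_space0 \<gamma>"
  unfolding growth_space0_iff
proof (intro conjI allI impI hol)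
  fix \<epsilon> :: real assume "\<epsilon> > 0"
  then obtain \<psi> where \<psi>: "\<psi> \<in> growth_space0 \<gamma>"
    "\<And>z. norm z < 1 \<Longrightarrow> (1 - norm z) powr \<gamma> * norm (\<phi> z - \<psi> z) \<le> \<epsilon> / 2"
    using approx[of "\<epsilon> / 2"] by auto
  obtain r where r: "r < 1" "\<And>z. r < norm z \<Longrightarrow> norm z < 1 \<Longrightarrow> (1 - norm z) powr \<gamma> * norm (\<psi> z) < \<epsilon> / 2"
    using \<psi>(1) \<open>\<epsilon> > 0\<close> unfolding growth_space0_iff by (meson half_gt_zero)
  have "(1 - norm z) powr \<gamma> * norm (\<phi> z) < \<epsilon>" if "r < norm z" "norm z < 1" for z
    using mult_left_mono[OF norm_triangle_ineq[of "\<phi> z - \<psi> z" "\<psi> z"] powr_ge_zero[of "1 - norm z" \<gamma>]]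
      \<psi>(2)[of z] r(2)[of z] that by (simp add: distrib_left)
  with r show "\<exists>r<1. \<forall>z. r < norm z \<longrightarrow> norm z < 1 \<longrightarrow> (1 - norm z) powr \<gamma> * norm (\<phi> z) < \<epsilon>"
    by blast
qed

text \<open>A single \<psi> at finite weighted distance suffices, because the difference then lies
  in the growth space too.\<close>

lemma growth_space_closed:
  assumes hol: "\<phi> holomorphic_on unit_disc" and \<psi>: "\<psi> \<in> growth_space \<gamma>"
    and approx: "\<And>z. z \<in> unit_disc \<Longrightarrow> (1 - norm z) powr \<gamma> * norm (\<phi> z - \<psi> z) \<le> \<delta>"
  shows "\<phi> \<in> growth_space \<gamma>"
proof -
  have "(\<lambda>z. \<phi> z - \<psi> z) \<in> growth_space \<gamma>"
    using hol \<psi> approx by (auto simp: growth_space_iff intro!: holomorphic_intros)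
  from growth_space_add[OF this \<psi>] show ?thesis by simp
qed

text \<open>\<open>Y\<close> stands for either growth space of the derivatives, so \<gamma> is here
  the exponent \<gamma> + 1 of the theorem. The map from \<open>f\<close> to \<open>f\<close> times
  \<open>deriv g\<close> carries the structure of \<open>Y\<close> over to \<open>X\<close>, with
  the weight \<open>u\<close> absorbing |g'|. Since it commutes with multiplication by
  \<open>h\<close>, bounded functions are multipliers of \<open>X\<close>; the other inclusion is
  \<open>multiplier_of_weighted_space_bounded\<close>.\<close>

lemma multipliers_weighted_eq_H_infty:
  fixes g :: "complex \<Rightarrow> complex" and \<gamma> :: real
  assumes g: "g \<in> hol_disc" "\<not> g constant_on unit_disc"
    and X: "X = {f \<in> hol_disc. (\<lambda>z. f z * deriv g z) \<in> Y}"
    and Y: "Y \<subseteq> growth_space \<gamma>" "deriv g \<in> Y"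
    and add: "\<And>\<phi> \<psi>. \<lbrakk>\<phi> \<in> Y; \<psi> \<in> Y\<rbrakk> \<Longrightarrow> (\<lambda>z. \<phi> z + \<psi> z) \<in> Y"
    and mult: "\<And>h \<phi>. \<lbrakk>h \<in> H_infty; \<phi> \<in> Y\<rbrakk> \<Longrightarrow> (\<lambda>z. h z * \<phi> z) \<in> Y"
    and closed: "\<And>\<phi>. \<lbrakk>\<phi> holomorphic_on unit_disc; \<And>\<delta>. \<delta> > 0 \<Longrightarrow>
        \<exists>\<psi>\<in>Y. \<forall>z\<in>unit_disc. (1 - norm z) powr \<gamma> * norm (\<phi> z - \<psi> z) \<le> \<delta>\<rbrakk> \<Longrightarrow> \<phi> \<in> Y"
  shows "multipliers X = H_infty"
proof (intro subset_antisym subsetI)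
  fix h assume h: "h \<in> H_infty"
  then have "h \<in> hol_disc" by (simp add: H_infty_def)
  moreover have "(\<lambda>z. h z * f z) \<in> X" if "f \<in> X" for f
    using that mult[OF h, of "\<lambda>z. f z * deriv g z"] \<open>h \<in> hol_disc\<close>
    by (auto simp: X hol_disc_def mult.assoc intro!: holomorphic_intros)
  ultimately show "h \<in> multipliers X" by (simp add: multipliers_def)
next
  have hol_g': "deriv g holomorphic_on unit_disc"
    using g by (auto simp: hol_disc_def intro: holomorphic_deriv)
  define u where "u z = (1 - norm z) powr \<gamma> * norm (deriv g z)" for z
  have u: "u z * norm w = (1 - norm z) powr \<gamma> * norm (w * deriv g z)" for z w
    by (simp add: u_def norm_mult mult_ac)
  fix h assume "h \<in> multipliers X"
  then show "h \<in> H_infty"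
  proof (rule multiplier_of_weighted_space_bounded[where u = u and X = X, rotated -1])
    show "u z \<ge> 0" for z by (simp add: u_def)
    have "{z \<in> unit_disc. u z > 0} = {z \<in> unit_disc. deriv g z \<noteq> 0}"
      by (auto simp: u_def)
    then show "unit_disc \<subseteq> closure {z \<in> unit_disc. u z > 0}"
      using deriv_nonzero_dense[OF g] by simp
    show "(\<lambda>z. f z + k z) \<in> X" if "f \<in> X" "k \<in> X" for f k
      using that add[of "\<lambda>z. f z * deriv g z" "\<lambda>z. k z * deriv g z"]
      by (auto simp: X hol_disc_def distrib_right intro!: holomorphic_intros)
    \<comment> \<open>Constants are bounded functions, so scaling is an instance of
      \<open>mult\<close>.\<close>
    show "(\<lambda>z. c * f z) \<in> X" if "f \<in> X" for c f
      using that mult[OF constant_in_H_infty, of "\<lambda>z. f z * deriv g z" c]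
      by (auto simp: X hol_disc_def mult.assoc intro!: holomorphic_intros)
    show "(\<lambda>z. 1) \<in> X" using Y by (simp add: X hol_disc_def)
    show "\<exists>B. \<forall>z\<in>unit_disc. u z * norm (f z) \<le> B" if "f \<in> X" for f
      using that subsetD[OF Y(1), of "\<lambda>z. f z * deriv g z"] unfolding u
      by (simp add: X growth_space_iff Ball_def)
    fix f assume f: "f \<in> hol_disc"
      and approx: "\<And>\<delta>. \<delta> > 0 \<Longrightarrow> \<exists>p\<in>X. \<forall>z\<in>unit_disc. u z * norm (f z - p z) \<le> \<delta>"
    have "(\<lambda>z. f z * deriv g z) \<in> Y"
    proof (rule closed)
      show "(\<lambda>z. f z * deriv g z) holomorphic_on unit_disc"
        using f hol_g' by (auto simp: hol_disc_def intro!: holomorphic_intros)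
      fix \<delta> :: real assume "\<delta> > 0"
      from approx[OF this] obtain p where p: "p \<in> X" "\<And>z. z \<in> unit_disc \<Longrightarrow> u z * norm (f z - p z) \<le> \<delta>"
        by blast
      then show "\<exists>\<psi>\<in>Y. \<forall>z\<in>unit_disc. (1 - norm z) powr \<gamma> * norm (f z * deriv g z - \<psi> z) \<le> \<delta>"
        unfolding u by (intro bexI[of _ "\<lambda>z. p z * deriv g z"]) (auto simp: X left_diff_distrib)
    qed
    with f show "f \<in> X" by (simp add: X)
  qed
qed

theorem corollary4p3:
  fixes g :: "complex \<Rightarrow> complex" and \<gamma> :: real
  assumes "g \<in> Bloch"
    and "\<not> g constant_on unit_disc"
    and "\<gamma> > 0"
  shows "multipliers (optimal_domain g (growth_space \<gamma>)) = H_infty \<and>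
         multipliers (optimal_domain g (growth_space0 \<gamma>)) = H_infty"
proof
  have g: "g \<in> hol_disc" using assms(1) by (simp add: Bloch_def)
  note g'0 = Bloch_deriv_in_growth_space0[OF assms(1,3)]
  show "multipliers (optimal_domain g (growth_space \<gamma>)) = H_infty"
  proof (rule multipliers_weighted_eq_H_infty[OF g assms(2) optimal_domain_growth_space[OF g assms(3)] subset_refl])
    show "deriv g \<in> growth_space (\<gamma> + 1)" using g'0 growth_space0_subset by blast
    fix \<phi> assume hol: "\<phi> holomorphic_on unit_disc" and "\<And>\<delta>. \<delta> > 0 \<Longrightarrow> \<exists>\<psi>\<in>growth_space (\<gamma> + 1).
      \<forall>z\<in>unit_disc. (1 - norm z) powr (\<gamma> + 1) * norm (\<phi> z - \<psi> z) \<le> \<delta>"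
    from this(2)[OF zero_less_one] show "\<phi> \<in> growth_space (\<gamma> + 1)"
      using growth_space_closed[OF hol] by blast
  qed (fact growth_space_add bounded_multiplier_growth_space)+
  show "multipliers (optimal_domain g (growth_space0 \<gamma>)) = H_infty"
    by (rule multipliers_weighted_eq_H_infty[OF g assms(2) optimal_domain_growth_space0[OF g assms(3)]
          growth_space0_subset g'0 growth_space0_add bounded_multiplier_growth_space0 growth_space0_closed])
qed
end
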